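(* Let $\mathfrak{A}$ be a set with a reflexive, symmetric binary relation ("linked"), and let $L$ be a constant such that each element of $\mathfrak{A}$ is linked to at most $L$ elements of $\mathfrak{A}$. Denote $C_L=\ln L+L^2$. Then for any family $\alpha=\{(T_1,n_1),\ldots,(T_m,n_m)\}$ of elements of $\mathfrak{A}$ with $m\ge1$, $$C_L\sum_{i=1}^m n_i+\sum_{i=1}^m n_i\ln n_i>\sum_{i=1}^m n_i\ln\upsilon_\alpha(T_i).$$
   Context: A family of elements of $\mathfrak{A}$ is a set of pairs $\alpha=\{(T_1,n_1),\ldots,(T_m,n_m)\}$ where $T_1,\ldots,T_m$ are distinct elements of $\mathfrak{A}$ and each $n_i\ge1$ is an integer. For $i=1,\ldots,m$, $\upsilon_\alpha(T_i)=\sum_{\{j\in\{1,\ldots,m\}:\ T_j\text{ is linked to }T_i\}}n_j$. By reflexivity each element is linked to itself, and this is counted among the at most $L$ linked elements. *)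

theory Defs
  imports Complex_Main
begin

text \<open>
  A family is literally a finite set of pairs $(T_i, n_i)$; injectivity of \<open>fst\<close> on it says that
  the $T_i$ are pairwise distinct.
\<close>

definition is_family :: "'a set \<Rightarrow> ('a \<times> nat) set \<Rightarrow> bool" where
  "is_family A \<alpha> \<longleftrightarrow>
     finite \<alpha> \<and> fst ` \<alpha> \<subseteq> A \<and> inj_on fst \<alpha> \<and> (\<forall>(T, n)\<in>\<alpha>. n \<ge> 1)"

definition upsilon :: "('a \<Rightarrow> 'a \<Rightarrow> bool) \<Rightarrow> ('a \<times> nat) set \<Rightarrow> 'a \<Rightarrow> nat" where
  "upsilon linked \<alpha> T = (\<Sum>(S, n) \<in> {(S, n) \<in> \<alpha>. linked S T}. n)"

definition C_const :: "real \<Rightarrow> real" where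
  "C_const L = ln L + L\<^sup>2"

end

theory Submission
  imports Defs
begin

text \<open>
  Write \<open>N\<close> for the sum of the multiplicities and \<open>v\<^sub>i\<close> for the value of \<open>upsilon\<close> at \<open>T\<^sub>i\<close>. The
  claim bounds the sum of the entropy-like terms \<open>n\<^sub>i ln (v\<^sub>i / n\<^sub>i)\<close> by a multiple of \<open>N\<close>. The
  ratio \<open>v\<^sub>i / n\<^sub>i\<close> can be arbitrarily large for a single \<open>i\<close>, so the bound has to come from an
  average. The tangent line of the concave function \<open>ln\<close> at \<open>L\<close> gives
  \<open>n\<^sub>i ln (v\<^sub>i / n\<^sub>i) \<le> n\<^sub>i ln L + v\<^sub>i / L - n\<^sub>i\<close> (lemma \<open>ln_tangent_weighted\<close>), which is linear
  in \<open>v\<^sub>i\<close>; and the \<open>v\<^sub>i\<close> sum to at most \<open>L N\<close>, because each \<open>n\<^sub>j\<close> contributes to at most \<open>L\<close>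
  of them (lemma \<open>sum_upsilon_le\<close>). Summing, the last two terms contribute at most
  \<open>L N / L - N = 0\<close>, so the entropy-like sum is at most \<open>N ln L\<close>. This is strictly less than
  \<open>(ln L + L\<^sup>2) N\<close>.
\<close>

text \<open>
  The inequality \<open>ln x \<le> x - 1\<close> at \<open>x = v / (n L)\<close>, multiplied by \<open>n\<close>: the point of tangency
  \<open>v / n = L\<close> is the worst ratio that can occur on average.
\<close>

lemma ln_tangent_weighted:
  fixes n v L :: real
  assumes "n > 0" "v > 0" "L > 0"
  shows "n * ln v \<le> n * ln n + n * ln L + v / L - n"
proof -
  have "ln (v / (n * L)) \<le> v / (n * L) - 1"
    using assms by (intro ln_le_minus_one) simp
  moreover have "ln (v / (n * L)) = ln v - ln n - ln L"
    using assms by (simp add: ln_div ln_mult)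
  ultimately have "n * (ln v - ln n - ln L) \<le> n * (v / (n * L) - 1)"
    using assms by (intro mult_left_mono) auto
  also have "\<dots> = v / L - n"
    using assms by (simp add: field_simps)
  finally show ?thesis
    by (simp add: algebra_simps)
qed

text \<open>
  Double counting: \<open>k\<close> occurs in the value of \<open>upsilon\<close> at \<open>T\<close> exactly when its partner \<open>S\<close> is
  linked to \<open>T\<close>, so after exchanging the two sums \<open>k\<close> is multiplied by the number of members of
  the family linked to \<open>S\<close>. As the members have distinct first components, this number is at most
  the number of elements of \<open>A\<close> linked to \<open>S\<close>.
\<close>

lemma sum_upsilon_le:
  fixes L :: real
  assumes family: "is_family A \<alpha>"
    and degree: "\<And>T. T \<in> A \<Longrightarrow>
      finite {S \<in> A. linked T S} \<and> real (card {S \<in> A. linked T S}) \<le> L"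
  shows "(\<Sum>(T, n)\<in>\<alpha>. real (upsilon linked \<alpha> T)) \<le> L * (\<Sum>(T, n)\<in>\<alpha>. real n)"
proof -
  have fin: "finite \<alpha>" and sub: "fst ` \<alpha> \<subseteq> A" and inj: "inj_on fst \<alpha>"
    using family by (auto simp: is_family_def)
  have ups: "real (upsilon linked \<alpha> T)
      = (\<Sum>q\<in>\<alpha>. if linked (fst q) T then real (snd q) else 0)" for T
  proof -
    have "upsilon linked \<alpha> T = (\<Sum>q\<in>{q \<in> \<alpha>. linked (fst q) T}. snd q)"
      unfolding upsilon_def by (rule sum.cong) auto
    then show ?thesis
      using fin by (simp add: sum.inter_filter if_distrib cong: if_cong)
  qed
  have deg: "real (card {p \<in> \<alpha>. linked S (fst p)}) \<le> L" if "S \<in> A" for S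
  proof -
    have "card {p \<in> \<alpha>. linked S (fst p)} \<le> card {T \<in> A. linked S T}"
    proof (rule card_inj_on_le)
      show "inj_on fst {p \<in> \<alpha>. linked S (fst p)}"
        using inj by (rule inj_on_subset) auto
    qed (use sub degree[OF that] in auto)
    then show ?thesis
      using degree[OF that] by linarith
  qed
  have "(\<Sum>(T, n)\<in>\<alpha>. real (upsilon linked \<alpha> T))
      = (\<Sum>p\<in>\<alpha>. \<Sum>q\<in>\<alpha>. if linked (fst q) (fst p) then real (snd q) else 0)"
    by (simp add: ups split_beta)
  also have "\<dots> = (\<Sum>q\<in>\<alpha>. \<Sum>p\<in>\<alpha>. if linked (fst q) (fst p) then real (snd q) else 0)"
    by (rule sum.swap)
  also have "\<dots> = (\<Sum>q\<in>\<alpha>. real (card {p \<in> \<alpha>. linked (fst q) (fst p)}) * real (snd q))"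
    using fin by (simp flip: sum.inter_filter)
  also have "\<dots> \<le> (\<Sum>q\<in>\<alpha>. L * real (snd q))"
    using deg sub by (intro sum_mono mult_right_mono) auto
  also have "\<dots> = L * (\<Sum>(T, n)\<in>\<alpha>. real n)"
    by (simp add: sum_distrib_left split_beta)
  finally show ?thesis .
qed

text \<open>
  Each member is linked to itself and so contributes to its own value of \<open>upsilon\<close>. Hence this
  value is positive, as is required for taking its logarithm.
\<close>

lemma multiplicity_le_upsilon:
  assumes "reflp_on A linked" "is_family A \<alpha>" "(T, n) \<in> \<alpha>"
  shows "n \<le> upsilon linked \<alpha> T"
proof -
  have "linked T T"
    using assms by (force simp: is_family_def reflp_on_def)
  moreover have "finite {(S, k) \<in> \<alpha>. linked S T}"
    using assms(2) by (auto simp: is_family_def intro: rev_finite_subset)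
  ultimately show ?thesis
    unfolding upsilon_def using assms(3)
      member_le_sum[of "(T, n)" "{(S, k) \<in> \<alpha>. linked S T}" "\<lambda>(S, k). k"] by auto
qed

theorem theorem4p1:
  fixes A :: "'a set" and linked :: "'a \<Rightarrow> 'a \<Rightarrow> bool" and L :: real
    and \<alpha> :: "('a \<times> nat) set"
  assumes "reflp_on A linked" and "symp_on A linked"
    and "\<And>T. T \<in> A \<Longrightarrow>
      finite {S \<in> A. linked T S} \<and> real (card {S \<in> A. linked T S}) \<le> L"
    and "is_family A \<alpha>" and "card \<alpha> \<ge> 1"
  shows "C_const L * (\<Sum>(T, n)\<in>\<alpha>. real n) + (\<Sum>(T, n)\<in>\<alpha>. real n * ln (real n))
    > (\<Sum>(T, n)\<in>\<alpha>. real n * ln (real (upsilon linked \<alpha> T)))"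
proof -
  define N where "N = (\<Sum>(T, n)\<in>\<alpha>. real n)"
  define E where "E = (\<Sum>(T, n)\<in>\<alpha>. real n * ln (real n))"
  define U where "U = (\<Sum>(T, n)\<in>\<alpha>. real (upsilon linked \<alpha> T))"
  have fin: "finite \<alpha>" and pos: "\<And>T n. (T, n) \<in> \<alpha> \<Longrightarrow> n \<ge> 1"
    using assms(4) by (auto simp: is_family_def)
  have ne: "\<alpha> \<noteq> {}"
    using assms(5) by auto
  obtain T where T: "T \<in> A"
    using ne assms(4) by (auto simp: is_family_def)
  \<comment> \<open>A member of the family is linked to itself, so its degree, and with it \<open>L\<close>, is positive.\<close>
  have L: "L > 0"
  proof -
    have "T \<in> {S \<in> A. linked T S}"
      using T assms(1) by (auto simp: reflp_on_def)
    then have "card {S \<in> A. linked T S} > 0"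
      using assms(3)[OF T] card_gt_0_iff by blast
    then show ?thesis
      using assms(3)[OF T] by linarith
  qed
  have N: "N > 0"
    unfolding N_def using fin ne pos by (intro sum_pos) (auto simp: Suc_le_eq)
  have "U / L \<le> N"
    using sum_upsilon_le[OF assms(4,3)] L
    by (simp add: U_def N_def divide_le_eq mult.commute)
  have "(\<Sum>(T, n)\<in>\<alpha>. real n * ln (real (upsilon linked \<alpha> T)))
      \<le> (\<Sum>(T, n)\<in>\<alpha>. real n * ln (real n) + real n * ln L
            + real (upsilon linked \<alpha> T) / L - real n)"
  proof (rule sum_mono, clarify)
    fix T n
    assume mem: "(T, n) \<in> \<alpha>"
    then show "real n * ln (real (upsilon linked \<alpha> T))
        \<le> real n * ln (real n) + real n * ln L + real (upsilon linked \<alpha> T) / L - real n"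
      using pos[OF mem] multiplicity_le_upsilon[OF assms(1,4) mem] L
      by (intro ln_tangent_weighted) auto
  qed
  also have "\<dots> = E + N * ln L + U / L - N"
    by (simp add: E_def N_def U_def split_beta sum.distrib sum_subtractf
        sum_distrib_right sum_divide_distrib)
  also have "\<dots> \<le> E + N * ln L"
    using \<open>U / L \<le> N\<close> by simp
  also have "\<dots> < E + N * ln L + N * L\<^sup>2"
    using N L by simp
  also have "\<dots> = C_const L * N + E"
    by (simp add: C_const_def algebra_simps)
  finally show ?thesis
    by (simp add: N_def E_def)
qed

end
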